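(* Let $G$ be a topological group, and let $[G,G]$ be its commutator subgroup. Then the maps $\mathrm{AfCom}_n(G)\to[G,G]^n$ given by $(g_0,\dots,g_n)\mapsto([g_0,g_1],\dots,[g_{n-1},g_n])$ assemble to give a simplicial map $\mathfrak{c}_\bullet\colon\mathrm{AfCom}_\bullet(G)\to N[G,G]$, which geometrically realizes to a map $\mathfrak{c}\colon E_{\mathrm{com}}G\to B[G,G]$.
   Context: Commutators are $[x,y]=x^{-1}y^{-1}xy$. $\mathrm{AfCom}_n(G)\subseteq G^{n+1}$ is the subspace of affinely commutative tuples, i.e. tuples $(g_0,\dots,g_n)$ whose consecutive quotients $g_0^{-1}g_1,\dots,g_{n-1}^{-1}g_n$ pairwise commute; these form a simplicial space $\mathrm{AfCom}_\bullet(G)$ with $d_i$ deleting the $i$-th coordinate and $s_i$ repeating the $i$-th coordinate. $E_{\mathrm{com}}G$ is identified with $|\mathrm{AfCom}_\bullet(G)|$. For a topological group $H$, the nerve $NH$ is the simplicial space with $(NH)_n=H^n$, whose face maps $d_i\colon H^n\to H^{n-1}$ multiply two adjacent coordinates for $0<i<n$, while $d_0$ and $d_n$ drop the first and last coordinate respectively, and whose degeneracies $s_i\colon H^n\to H^{n+1}$ insert the identity element in the $i$-th position; $BH=|NH|$. *)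

theory Defs
  imports "HOL-Homology.Homology" "HOL-Algebra.Generated_Groups"
begin

section \<open>Topological groups\<close>

locale topological_group = group G
  for G :: "('a, 'b) monoid_scheme" (structure) and T :: "'a topology" +
  assumes topspace_eq_carrier: "topspace T = carrier G"
    and continuous_mult: "continuous_map (prod_topology T T) T (\<lambda>(x, y). x \<otimes> y)"
    and continuous_inv: "continuous_map T T (\<lambda>x. inv x)"

definition commutator :: "('a, 'b) monoid_scheme \<Rightarrow> 'a \<Rightarrow> 'a \<Rightarrow> 'a" where
  "commutator G x y = inv\<^bsub>G\<^esub> x \<otimes>\<^bsub>G\<^esub> inv\<^bsub>G\<^esub> y \<otimes>\<^bsub>G\<^esub> x \<otimes>\<^bsub>G\<^esub> y"

definition commutator_subgroup :: "('a, 'b) monoid_scheme \<Rightarrow> ('a, 'b) monoid_scheme" where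
  "commutator_subgroup G = G\<lparr>carrier := derived G (carrier G)\<rparr>"

definition commutator_topology :: "('a, 'b) monoid_scheme \<Rightarrow> 'a topology \<Rightarrow> 'a topology" where
  "commutator_topology G T = subtopology T (derived G (carrier G))"

text \<open>The library generates \<^const>\<open>derived\<close> by the elements \<open>x y x\<inverse> y\<inverse>\<close>; these are the same elements
  as the commutators in the convention used here.\<close>

lemma (in group) derived_eq_generate_commutators:
  "derived G (carrier G) = generate G {commutator G x y | x y. x \<in> carrier G \<and> y \<in> carrier G}"
proof -
  have 1: "\<exists>x' y'. x \<otimes> y \<otimes> inv x \<otimes> inv y = commutator G x' y' \<and> x' \<in> carrier G \<and> y' \<in> carrier G"
    if "x \<in> carrier G" "y \<in> carrier G" for x y
    using that by (intro exI[of _ "inv x"] exI[of _ "inv y"]) (simp add: commutator_def)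
  have 2: "commutator G x y \<in> derived_set G (carrier G)" if "x \<in> carrier G" "y \<in> carrier G" for x y
  proof -
    have "commutator G x y = inv x \<otimes> inv y \<otimes> inv (inv x) \<otimes> inv (inv y)"
      using that by (simp add: commutator_def)
    moreover have "inv x \<in> carrier G" "inv y \<in> carrier G"
      using that by simp_all
    ultimately show ?thesis
      unfolding UN_iff singleton_iff
      by (intro bexI[of _ "inv x"] bexI[of _ "inv y"])
  qed
  have "derived_set G (carrier G) = {commutator G x y | x y. x \<in> carrier G \<and> y \<in> carrier G}"
  proof (intro equalityI subsetI)
    fix z assume "z \<in> derived_set G (carrier G)"
    then obtain x y where xy: "x \<in> carrier G" "y \<in> carrier G" and "z = x \<otimes> y \<otimes> inv x \<otimes> inv y"
      unfolding UN_iff singleton_iff by (elim bexE)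
    with 1[OF xy] show "z \<in> {commutator G x y | x y. x \<in> carrier G \<and> y \<in> carrier G}"
      by auto
  next
    fix z assume "z \<in> {commutator G x y | x y. x \<in> carrier G \<and> y \<in> carrier G}"
    then obtain x y where "x \<in> carrier G" "y \<in> carrier G" "z = commutator G x y"
      by blast
    with 2 show "z \<in> derived_set G (carrier G)"
      by simp
  qed
  then show ?thesis
    by (simp add: derived_def)
qed

section \<open>Simplicial spaces\<close>

text \<open>\<open>face X n i\<close> is \<open>d\<^sub>i : X\<^sub>n \<rightarrow> X\<^sub>n\<^sub>-\<^sub>1\<close> (only meaningful for \<open>n > 0\<close>, \<open>i \<le> n\<close>) and \<open>degen X n i\<close> is
  \<open>s\<^sub>i : X\<^sub>n \<rightarrow> X\<^sub>n\<^sub>+\<^sub>1\<close> (for \<open>i \<le> n\<close>).\<close>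

record 'a simplicial_data =
  level :: "nat \<Rightarrow> 'a topology"
  face :: "nat \<Rightarrow> nat \<Rightarrow> 'a \<Rightarrow> 'a"
  degen :: "nat \<Rightarrow> nat \<Rightarrow> 'a \<Rightarrow> 'a"

locale simplicial_space =
  fixes X :: "'a simplicial_data"
  assumes continuous_face:
      "\<lbrakk>0 < n; i \<le> n\<rbrakk> \<Longrightarrow> continuous_map (level X n) (level X (n - 1)) (face X n i)"
    and continuous_degen:
      "i \<le> n \<Longrightarrow> continuous_map (level X n) (level X (Suc n)) (degen X n i)"
    and face_face:
      "\<lbrakk>i < j; j \<le> n; 2 \<le> n; x \<in> topspace (level X n)\<rbrakk>
        \<Longrightarrow> face X (n - 1) i (face X n j x) = face X (n - 1) (j - 1) (face X n i x)"
    and degen_degen: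
      "\<lbrakk>i \<le> j; j \<le> n; x \<in> topspace (level X n)\<rbrakk>
        \<Longrightarrow> degen X (Suc n) i (degen X n j x) = degen X (Suc n) (Suc j) (degen X n i x)"
    and face_degen_less:
      "\<lbrakk>i < j; j \<le> n; x \<in> topspace (level X n)\<rbrakk>
        \<Longrightarrow> face X (Suc n) i (degen X n j x) = degen X (n - 1) (j - 1) (face X n i x)"
    and face_degen_id:
      "\<lbrakk>i = j \<or> i = Suc j; j \<le> n; x \<in> topspace (level X n)\<rbrakk>
        \<Longrightarrow> face X (Suc n) i (degen X n j x) = x"
    and face_degen_greater:
      "\<lbrakk>Suc j < i; i \<le> Suc n; x \<in> topspace (level X n)\<rbrakk>
        \<Longrightarrow> face X (Suc n) i (degen X n j x) = degen X (n - 1) j (face X n (i - 1) x)"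

locale simplicial_map =
  source: simplicial_space X + target: simplicial_space Y
  for X :: "'a simplicial_data" and Y :: "'b simplicial_data" +
  fixes f :: "nat \<Rightarrow> 'a \<Rightarrow> 'b"
  assumes continuous: "continuous_map (level X n) (level Y n) (f n)"
    and commutes_face:
      "\<lbrakk>0 < n; i \<le> n; x \<in> topspace (level X n)\<rbrakk> \<Longrightarrow> f (n - 1) (face X n i x) = face Y n i (f n x)"
    and commutes_degen:
      "\<lbrakk>i \<le> n; x \<in> topspace (level X n)\<rbrakk> \<Longrightarrow> f (Suc n) (degen X n i x) = degen Y n i (f n x)"

section \<open>Geometric realization\<close>

definition quotient_topology :: "'a topology \<Rightarrow> ('a \<times> 'a) set \<Rightarrow> 'a set topology" where
  "quotient_topology P R = topology (\<lambda>\<U>. \<U> \<subseteq> topspace P // R \<and> openin P (\<Union>\<U>))"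

lemma openin_quotient_topology:
  assumes "equiv (topspace P) R"
  shows "openin (quotient_topology P R) \<U> \<longleftrightarrow> \<U> \<subseteq> topspace P // R \<and> openin P (\<Union>\<U>)"
proof -
  have "istopology (\<lambda>\<U>. \<U> \<subseteq> topspace P // R \<and> openin P (\<Union>\<U>))"
    unfolding istopology_def
  proof (intro conjI allI impI; (elim conjE)?)
    fix \<U> \<V>
    assume *: "\<U> \<subseteq> topspace P // R" "openin P (\<Union>\<U>)" "\<V> \<subseteq> topspace P // R" "openin P (\<Union>\<V>)"
    have "C = D" if "C \<in> \<U>" "D \<in> \<V>" "x \<in> C" "x \<in> D" for C D x
      using quotient_disj[OF assms, of C D] * that by auto
    then have "\<Union>(\<U> \<inter> \<V>) = \<Union>\<U> \<inter> \<Union>\<V>"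
      by auto
    then show "openin P (\<Union>(\<U> \<inter> \<V>))"
      using * by (simp add: openin_Int)
  next
    fix K assume "\<forall>\<U>\<in>K. \<U> \<subseteq> topspace P // R \<and> openin P (\<Union>\<U>)"
    then have "openin P (\<Union>\<U>\<in>K. \<Union>\<U>)"
      by (intro openin_Union) auto
    moreover have "\<Union>(\<Union>K) = (\<Union>\<U>\<in>K. \<Union>\<U>)"
      by blast
    ultimately show "openin P (\<Union>(\<Union>K))"
      by simp
  qed blast+
  then show ?thesis
    by (simp add: quotient_topology_def topology_inverse')
qed

lemma quotient_map_quotient_topology:
  assumes "equiv (topspace P) R"
  shows "quotient_map P (quotient_topology P R) (\<lambda>p. R `` {p})"
proof -
  have "openin (quotient_topology P R) (topspace P // R)"
    by (simp add: openin_quotient_topology[OF assms] Union_quotient[OF assms])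
  then have top: "topspace (quotient_topology P R) = topspace P // R"
    using openin_quotient_topology[OF assms, of "topspace (quotient_topology P R)"]
    by (intro antisym openin_subset) auto
  have "{p \<in> topspace P. R `` {p} \<in> \<U>} = \<Union>\<U>" if "\<U> \<subseteq> topspace P // R" for \<U>
  proof
    show "{p \<in> topspace P. R `` {p} \<in> \<U>} \<subseteq> \<Union>\<U>"
      using equiv_class_self[OF assms] by blast
    show "\<Union>\<U> \<subseteq> {p \<in> topspace P. R `` {p} \<in> \<U>}"
    proof
      fix p assume "p \<in> \<Union>\<U>"
      then obtain C where C: "C \<in> \<U>" "p \<in> C" by blast
      have *: "C \<in> topspace P // R" using C that by blast
      then have "p \<in> topspace P"
        using C Union_quotient[OF assms] by blast
      moreover obtain a where "C = R `` {a}"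
        using * by (rule quotientE)
      then have "R `` {p} = C"
        using C equiv_class_eq[OF assms, of a p] by simp
      ultimately show "p \<in> {p \<in> topspace P. R `` {p} \<in> \<U>}" using C by blast
    qed
  qed
  then show ?thesis
    unfolding quotient_map_def top openin_quotient_topology[OF assms]
    by (auto simp: quotient_def)
qed

abbreviation simplex_topology :: "nat \<Rightarrow> (nat \<Rightarrow> real) topology" where
  "simplex_topology n \<equiv> subtopology (powertop_real UNIV) (standard_simplex n)"

text \<open>The coface maps of the standard simplices are \<^const>\<open>simplical_face\<close>; the following are the
  codegeneracy maps, which add the coordinates \<open>i\<close> and \<open>i + 1\<close>.\<close>

definition simplex_degen :: "nat \<Rightarrow> (nat \<Rightarrow> real) \<Rightarrow> nat \<Rightarrow> real" where
  "simplex_degen i t = (\<lambda>j. if j < i then t j else if j = i then t i + t (Suc i) else t (Suc j))"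

type_synonym 'a realization_point = "nat \<times> 'a \<times> (nat \<Rightarrow> real)"

definition prerealization :: "'a simplicial_data \<Rightarrow> 'a realization_point topology" where
  "prerealization X = sum_topology (\<lambda>n. prod_topology (level X n) (simplex_topology n)) UNIV"

inductive realization_step ::
  "'a simplicial_data \<Rightarrow> 'a realization_point \<Rightarrow> 'a realization_point \<Rightarrow> bool"
  for X where
  face_step: "\<lbrakk>0 < n; i \<le> n; x \<in> topspace (level X n); t \<in> standard_simplex (n - 1)\<rbrakk>
    \<Longrightarrow> realization_step X (n - 1, face X n i x, t) (n, x, simplical_face i t)"
| degen_step: "\<lbrakk>i \<le> n; x \<in> topspace (level X n); t \<in> standard_simplex (Suc n)\<rbrakk>
    \<Longrightarrow> realization_step X (Suc n, degen X n i x, t) (n, x, simplex_degen i t)"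

definition realization_rel ::
  "'a simplicial_data \<Rightarrow> ('a realization_point \<times> 'a realization_point) set" where
  "realization_rel X = {(p, q). p \<in> topspace (prerealization X) \<and> q \<in> topspace (prerealization X)
     \<and> equivclp (realization_step X) p q}"

lemma equiv_realization_rel: "equiv (topspace (prerealization X)) (realization_rel X)"
  unfolding equiv_def realization_rel_def refl_on_def sym_def trans_def
  by (auto intro: equivclp_sym equivclp_trans)

definition realization :: "'a simplicial_data \<Rightarrow> 'a realization_point set topology" where
  "realization X = quotient_topology (prerealization X) (realization_rel X)"

definition realization_class :: "'a simplicial_data \<Rightarrow> 'a realization_point \<Rightarrow> 'a realization_point set"
  where "realization_class X p = realization_rel X `` {p}"

text \<open>For a simplicial map \<open>f\<close> all sets in the following union coincide, and the union is
  the class of \<open>(n, f n x, t)\<close> for any \<open>(n, x, t) \<in> C\<close>.\<close>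

definition realization_map ::
  "'b simplicial_data \<Rightarrow> (nat \<Rightarrow> 'a \<Rightarrow> 'b) \<Rightarrow> 'a realization_point set \<Rightarrow> 'b realization_point set"
  where "realization_map Y f C = (\<Union>(n, x, t)\<in>C. realization_class Y (n, f n x, t))"

section \<open>The nerve and the classifying space\<close>

text \<open>\<open>H\<^sup>n\<close> consists of functions on the index set \<open>{..<n}\<close>, so coordinates are numbered from \<open>0\<close>:
  an inner face \<open>d\<^sub>i\<close> multiplies the coordinates \<open>i - 1\<close> and \<open>i\<close>. For \<open>i = 0\<close> and \<open>i = n\<close> the product
  case below never applies, and the formula drops the first and the last coordinate, respectively.\<close>

definition nerve :: "('a, 'b) monoid_scheme \<Rightarrow> 'a topology \<Rightarrow> (nat \<Rightarrow> 'a) simplicial_data" where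
  "nerve H T = \<lparr>
     level = (\<lambda>n. product_topology (\<lambda>_. T) {..<n}),
     face = (\<lambda>n i h. \<lambda>j\<in>{..<n - 1}.
       if Suc j < i then h j else if Suc j = i then h j \<otimes>\<^bsub>H\<^esub> h (Suc j) else h (Suc j)),
     degen = (\<lambda>n i h. \<lambda>j\<in>{..<Suc n}.
       if j < i then h j else if j = i then \<one>\<^bsub>H\<^esub> else h (j - 1))\<rparr>"

definition classifying_space ::
  "('a, 'b) monoid_scheme \<Rightarrow> 'a topology \<Rightarrow> (nat \<Rightarrow> 'a) realization_point set topology" where
  "classifying_space H T = realization (nerve H T)"

section \<open>Affinely commutative tuples\<close>

definition affinely_commutative :: "('a, 'b) monoid_scheme \<Rightarrow> nat \<Rightarrow> (nat \<Rightarrow> 'a) set" where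
  "affinely_commutative G n = {g \<in> {..n} \<rightarrow>\<^sub>E carrier G. \<forall>i<n. \<forall>j<n.
     (inv\<^bsub>G\<^esub> g i \<otimes>\<^bsub>G\<^esub> g (Suc i)) \<otimes>\<^bsub>G\<^esub> (inv\<^bsub>G\<^esub> g j \<otimes>\<^bsub>G\<^esub> g (Suc j))
       = (inv\<^bsub>G\<^esub> g j \<otimes>\<^bsub>G\<^esub> g (Suc j)) \<otimes>\<^bsub>G\<^esub> (inv\<^bsub>G\<^esub> g i \<otimes>\<^bsub>G\<^esub> g (Suc i))}"

definition AfCom :: "('a, 'b) monoid_scheme \<Rightarrow> 'a topology \<Rightarrow> (nat \<Rightarrow> 'a) simplicial_data" where
  "AfCom G T = \<lparr>
     level = (\<lambda>n. subtopology (product_topology (\<lambda>_. T) {..n}) (affinely_commutative G n)),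
     face = (\<lambda>n i g. \<lambda>j\<in>{..n - 1}. if j < i then g j else g (Suc j)),
     degen = (\<lambda>n i g. \<lambda>j\<in>{..Suc n}. if j \<le> i then g j else g (j - 1))\<rparr>"

definition Ecom ::
  "('a, 'b) monoid_scheme \<Rightarrow> 'a topology \<Rightarrow> (nat \<Rightarrow> 'a) realization_point set topology" where
  "Ecom G T = realization (AfCom G T)"

definition commutator_map :: "('a, 'b) monoid_scheme \<Rightarrow> nat \<Rightarrow> (nat \<Rightarrow> 'a) \<Rightarrow> nat \<Rightarrow> 'a" where
  "commutator_map G n g = (\<lambda>i\<in>{..<n}. commutator G (g i) (g (Suc i)))"

text \<open>The induced map \<open>E\<^sub>c\<^sub>o\<^sub>m G \<rightarrow> B[G,G]\<close>.\<close>

definition realized_commutator_map :: "('a, 'b) monoid_scheme \<Rightarrow> 'a topology \<Rightarrow>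
    (nat \<Rightarrow> 'a) realization_point set \<Rightarrow> (nat \<Rightarrow> 'a) realization_point set" where
  "realized_commutator_map G T =
     realization_map (nerve (commutator_subgroup G) (commutator_topology G T)) (commutator_map G)"

end

theory Submission
  imports Defs
begin

text \<open>
  Write \<open>a = x\<inverse>y\<close> and \<open>b = y\<inverse>z\<close>. Then \<open>[x,y] = x\<inverse>a\<inverse>xa\<close>, \<open>[y,z] = a\<inverse>x\<inverse>b\<inverse>xab\<close> and
  \<open>[x,z] = x\<inverse>(ab)\<inverse>xab\<close>, so that \<open>[x,y][y,z] = x\<inverse>a\<inverse>b\<inverse>xab\<close>. This equals \<open>[x,z]\<close> as soon as
  \<open>a\<close> and \<open>b\<close> commute (\<open>commutator_mult_commutator\<close>). In an affinely commutative tuple consecutive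
  quotients commute, so deleting an inner coordinate multiplies two adjacent commutators, which is
  the inner face of the nerve. Outer faces drop the first or the last commutator, and repeating a
  coordinate inserts \<open>[x,x] = \<one>\<close>. Together with the continuity of the group operations this is the
  simplicial map (\<open>simplicial_map_commutator_map\<close>).

  Two things have to hold for this to make sense. The affinely commutative tuples have to be stable
  under deleting and repeating coordinates: the commutation condition on consecutive quotients
  propagates to all quotients \<open>g\<^sub>i\<inverse>g\<^sub>j\<close>, so it survives every reindexing of the coordinates
  (\<open>affinely_commutative_reindex\<close>). And the nerve of \<open>[G,G]\<close> has to be a simplicial space, which is
  associativity and the unit law, once \<open>[G,G]\<close> is seen to be a topological group in the subspace
  topology.

  The statement about realizations is functoriality: a simplicial map \<open>f\<close> sends the generating
  identifications of the source to those of the target, so \<open>(n, x, t) \<mapsto> (n, f n x, t)\<close> descends to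
  the quotients (\<open>realization_map_class\<close>), and it is continuous by the universal property of the
  quotient topology (\<open>continuous_map_realization\<close>).
\<close>

section \<open>Functoriality of the geometric realization\<close>

lemma topspace_prerealization:
  "topspace (prerealization X) = {(n, x, t). x \<in> topspace (level X n) \<and> t \<in> standard_simplex n}"
  by (auto simp: prerealization_def)

lemma continuous_map_sum_topology_levelwise:
  assumes "\<And>n. n \<in> I \<Longrightarrow> continuous_map (X n) (Y n) (f n)"
  shows "continuous_map (sum_topology X I) (sum_topology Y I) (\<lambda>(n, x). (n, f n x))"
  unfolding continuous_map_def
proof (intro conjI allI impI)
  show "(\<lambda>(n, x). (n, f n x)) \<in> topspace (sum_topology X I) \<rightarrow> topspace (sum_topology Y I)"
    using continuous_map_funspace[OF assms] by fastforce
next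
  fix U assume U: "openin (sum_topology Y I) U"
  have "openin (X n) {x. (n, x) \<in> {p \<in> topspace (sum_topology X I). (\<lambda>(n, x). (n, f n x)) p \<in> U}}"
    if "n \<in> I" for n
  proof -
    have "openin (X n) {x \<in> topspace (X n). f n x \<in> {y. (n, y) \<in> U}}"
      using U that by (intro openin_continuous_map_preimage[OF assms]) (auto simp: openin_sum_topology)
    then show ?thesis
      using that by simp
  qed
  then show "openin (sum_topology X I) {p \<in> topspace (sum_topology X I). (\<lambda>(n, x). (n, f n x)) p \<in> U}"
    by (auto simp: openin_sum_topology)
qed

context simplicial_map
begin

lemma level_map_closed: "x \<in> topspace (level X n) \<Longrightarrow> f n x \<in> topspace (level Y n)"
  using continuous[of n] by (auto simp: continuous_map_def)

lemma continuous_map_prerealization: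
  "continuous_map (prerealization X) (prerealization Y) (\<lambda>(n, x, t). (n, f n x, t))"
proof -
  have "continuous_map (prod_topology (level X n) (simplex_topology n))
      (prod_topology (level Y n) (simplex_topology n)) (\<lambda>(x, t). (f n x, t))" for n
    using continuous[of n] by (simp add: continuous_map_prod_top)
  then have "continuous_map (prerealization X) (prerealization Y)
      (\<lambda>(n, p). (n, (\<lambda>(x, t). (f n x, t)) p))"
    unfolding prerealization_def by (rule continuous_map_sum_topology_levelwise)
  then show ?thesis
    by (simp add: case_prod_unfold)
qed

text \<open>The simplex coordinate is untouched by \<open>f\<close>, so the identification given by a face or a degeneracy
  of \<open>X\<close> goes to the one given by the same operator of \<open>Y\<close>; this is exactly what commuting with the
  operators provides.\<close>

lemma realization_step_map:
  assumes "realization_step X (n, x, t) (m, y, u)"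
  shows "realization_step Y (n, f n x, t) (m, f m y, u)"
  using assms
proof cases
  case (face_step i)
  then show ?thesis
    using realization_step.face_step[of m i "f m y" Y t]
    using commutes_face[of m i y] by (simp add: level_map_closed)
next
  case (degen_step i)
  then show ?thesis
    using realization_step.degen_step[of i m "f m y" Y t]
    using commutes_degen[of i m y] by (simp add: level_map_closed)
qed

lemma equivclp_realization_step_map:
  assumes "equivclp (realization_step X) (n, x, t) (m, y, u)"
  shows "equivclp (realization_step Y) (n, f n x, t) (m, f m y, u)"
proof -
  let ?F = "\<lambda>(n, x, t). (n, f n x, t)"
  have "equivclp (realization_step Y) (?F p) (?F q)" if "equivclp (realization_step X) p q" for p q
    using that
  proof (induction rule: equivclp_induct)
    case base
    show ?case by (simp add: equivclp_def)
  next
    case (step q r)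
    then have "realization_step Y (?F q) (?F r) \<or> realization_step Y (?F r) (?F q)"
      using realization_step_map by (auto split: prod.splits)
    then have "equivclp (realization_step Y) (?F q) (?F r)"
      by (auto intro: r_into_equivclp equivclp_sym)
    with step.IH show ?case
      by (rule equivclp_trans)
  qed
  from this[OF assms] show ?thesis by simp
qed

text \<open>Since \<open>f\<close> preserves the equivalence, the union that defines \<^const>\<open>realization_map\<close> is taken over
  a nonempty family whose members all coincide.\<close>

lemma realization_map_class:
  assumes "x \<in> topspace (level X n)" "t \<in> standard_simplex n"
  shows "realization_map Y f (realization_class X (n, x, t)) = realization_class Y (n, f n x, t)"
proof -
  have *: "(case p of (m, y, u) \<Rightarrow> realization_class Y (m, f m y, u)) = realization_class Y (n, f n x, t)"
    if "p \<in> realization_class X (n, x, t)" for p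
  proof -
    obtain m y u where p: "p = (m, y, u)"
      by (cases p)
    have "((n, x, t), (m, y, u)) \<in> realization_rel X"
      using that by (simp add: realization_class_def p)
    then have "((n, f n x, t), (m, f m y, u)) \<in> realization_rel Y"
      by (auto simp: realization_rel_def topspace_prerealization level_map_closed
          intro: equivclp_realization_step_map)
    then show ?thesis
      unfolding realization_class_def p prod.case
      by (intro equiv_class_eq[OF equiv_realization_rel, symmetric])
  qed
  have self: "(n, x, t) \<in> realization_class X (n, x, t)"
    unfolding realization_class_def using assms
    by (intro equiv_class_self[OF equiv_realization_rel]) (simp add: topspace_prerealization)
  show ?thesis
    unfolding realization_map_def by (intro SUP_eq_const *) (use self in auto)
qed

theorem continuous_map_realization:
  "continuous_map (realization X) (realization Y) (realization_map Y f)"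
proof -
  have quotient: "quotient_map (prerealization Z) (realization Z) (realization_class Z)"
    for Z :: "'c simplicial_data"
    using quotient_map_quotient_topology[OF equiv_realization_rel[of Z]]
    by (simp add: realization_def realization_class_def[abs_def])
  have "continuous_map (prerealization X) (realization Y)
      (realization_class Y \<circ> (\<lambda>(n, x, t). (n, f n x, t)))"
    using continuous_map_prerealization quotient_imp_continuous_map[OF quotient]
    by (rule continuous_map_compose)
  then have "continuous_map (prerealization X) (realization Y)
      (realization_map Y f \<circ> realization_class X)"
    by (rule continuous_map_eq) (auto simp: topspace_prerealization realization_map_class)
  with quotient show ?thesis
    by (rule continuous_compose_quotient_map)
qed

end

section \<open>The nerve of a topological group\<close>

context topological_group
begin

lemma continuous_map_mult:
  assumes "continuous_map X T f" "continuous_map X T g"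
  shows "continuous_map X T (\<lambda>x. f x \<otimes> g x)"
  using continuous_map_compose[OF continuous_map_pairedI[OF assms] continuous_mult]
  by (simp add: o_def)

lemma continuous_map_inv:
  assumes "continuous_map X T f"
  shows "continuous_map X T (\<lambda>x. inv f x)"
  using continuous_map_compose[OF assms continuous_inv] by (simp add: o_def)

lemma continuous_map_commutator:
  assumes "continuous_map X T f" "continuous_map X T g"
  shows "continuous_map X T (\<lambda>x. commutator G (f x) (g x))"
  unfolding commutator_def using assms by (intro continuous_map_mult continuous_map_inv)

lemma topological_group_subgroup:
  assumes "subgroup H G"
  shows "topological_group (G\<lparr>carrier := H\<rparr>) (subtopology T H)"
proof -
  interpret H: group "G\<lparr>carrier := H\<rparr>"
    using assms by (rule subgroup_imp_group)
  show ?thesis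
  proof
    show top: "topspace (subtopology T H) = carrier (G\<lparr>carrier := H\<rparr>)"
      using subgroup.subset[OF assms] by (auto simp: topspace_eq_carrier)
    have "continuous_map (prod_topology (subtopology T H) (subtopology T H)) T (\<lambda>p. fst p \<otimes> snd p)"
      by (intro continuous_map_mult continuous_map_into_fulltopology[OF continuous_map_fst]
          continuous_map_into_fulltopology[OF continuous_map_snd])
    then show "continuous_map (prod_topology (subtopology T H) (subtopology T H)) (subtopology T H)
        (\<lambda>(x, y). x \<otimes>\<^bsub>G\<lparr>carrier := H\<rparr>\<^esub> y)"
      using subgroup.m_closed[OF assms]
      by (auto simp: case_prod_unfold continuous_map_in_subtopology)
    have "continuous_map (subtopology T H) (subtopology T H) (\<lambda>x. inv x)"
      using continuous_inv subgroup.m_inv_closed[OF assms]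
      by (auto simp: continuous_map_in_subtopology continuous_map_from_subtopology)
    then show "continuous_map (subtopology T H) (subtopology T H) (\<lambda>x. inv\<^bsub>G\<lparr>carrier := H\<rparr>\<^esub> x)"
      by (rule continuous_map_eq) (use assms in \<open>auto simp: m_inv_consistent\<close>)
  qed
qed

text \<open>Among the simplicial identities, associativity enters only where two inner faces merge three
  adjacent coordinates, and the unit law only where an inner face multiplies the inserted \<open>\<one>\<close> with
  a neighbour; all the others merely renumber coordinates.\<close>

lemma simplicial_space_nerve: "simplicial_space (nerve G T)"
proof
  fix n i :: nat assume n: "0 < n" "i \<le> n"
  have coord: "continuous_map (product_topology (\<lambda>_. T) {..<n}) T (\<lambda>h. h j)" if "j < n" for j
    using that by (intro continuous_map_product_projection) simp
  show "continuous_map (level (nerve G T) n) (level (nerve G T) (n - 1)) (face (nerve G T) n i)"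
    unfolding nerve_def simplicial_data.simps
  proof (rule continuous_map_coordinatewise_then_product)
    fix j assume "j \<in> {..<n - 1}"
    then show "continuous_map (product_topology (\<lambda>_. T) {..<n}) T
        (\<lambda>h. (\<lambda>j\<in>{..<n - 1}. if Suc j < i then h j else if Suc j = i then h j \<otimes> h (Suc j)
           else h (Suc j)) j)"
      using continuous_map_mult[OF coord coord] coord by auto
  qed auto
next
  fix n i :: nat assume i: "i \<le> n"
  have coord: "continuous_map (product_topology (\<lambda>_. T) {..<n}) T (\<lambda>h. h j)" if "j < n" for j
    using that by (intro continuous_map_product_projection) simp
  show "continuous_map (level (nerve G T) n) (level (nerve G T) (Suc n)) (degen (nerve G T) n i)"
    unfolding nerve_def simplicial_data.simps
  proof (rule continuous_map_coordinatewise_then_product)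
    fix j assume "j \<in> {..<Suc n}"
    then show "continuous_map (product_topology (\<lambda>_. T) {..<n}) T
        (\<lambda>h. (\<lambda>j\<in>{..<Suc n}. if j < i then h j else if j = i then \<one> else h (j - 1)) j)"
      using coord i by (auto simp: topspace_eq_carrier)
  qed auto
next
  fix i j n :: nat and h
  assume "i < j" "j \<le> n" "2 \<le> n" and h: "h \<in> topspace (level (nerve G T) n)"
  have "h k \<in> carrier G" if "k < n" for k
    using h that by (auto simp: nerve_def topspace_eq_carrier)
  with \<open>i < j\<close> \<open>j \<le> n\<close> \<open>2 \<le> n\<close>
  show "face (nerve G T) (n - 1) i (face (nerve G T) n j h)
      = face (nerve G T) (n - 1) (j - 1) (face (nerve G T) n i h)"
    by (auto simp: nerve_def fun_eq_iff restrict_def m_assoc)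
next
  fix i j n :: nat and h
  assume "i \<le> j" "j \<le> n"
  then show "degen (nerve G T) (Suc n) i (degen (nerve G T) n j h)
      = degen (nerve G T) (Suc n) (Suc j) (degen (nerve G T) n i h)"
    by (auto simp: nerve_def fun_eq_iff restrict_def)
next
  fix i j n :: nat and h
  assume "i < j" "j \<le> n" and h: "h \<in> topspace (level (nerve G T) n)"
  have "h k \<in> carrier G" if "k < n" for k
    using h that by (auto simp: nerve_def topspace_eq_carrier)
  with \<open>i < j\<close> \<open>j \<le> n\<close> show "face (nerve G T) (Suc n) i (degen (nerve G T) n j h)
      = degen (nerve G T) (n - 1) (j - 1) (face (nerve G T) n i h)"
    by (auto simp: nerve_def fun_eq_iff restrict_def)
next
  fix i j n :: nat and h
  assume "i = j \<or> i = Suc j" "j \<le> n" and h: "h \<in> topspace (level (nerve G T) n)"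
  have "h k \<in> carrier G" if "k < n" for k
    using h that by (auto simp: nerve_def topspace_eq_carrier)
  moreover have "h k = undefined" if "\<not> k < n" for k
    using h that by (auto simp: nerve_def PiE_iff extensional_def)
  ultimately show "face (nerve G T) (Suc n) i (degen (nerve G T) n j h) = h"
    using \<open>i = j \<or> i = Suc j\<close> \<open>j \<le> n\<close> by (auto simp: nerve_def fun_eq_iff restrict_def)
next
  fix i j n :: nat and h
  assume "Suc j < i" "i \<le> Suc n" and h: "h \<in> topspace (level (nerve G T) n)"
  have "h k \<in> carrier G" if "k < n" for k
    using h that by (auto simp: nerve_def topspace_eq_carrier)
  \<comment> \<open>Both sides multiply the coordinates \<open>i - 2\<close> and \<open>i - 1\<close> of \<open>h\<close>; on the right the latter index
    arises as the successor of a truncated difference.\<close>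
  moreover have "Suc (i - Suc (Suc 0)) = i - Suc 0"
    using \<open>Suc j < i\<close> by simp
  ultimately show "face (nerve G T) (Suc n) i (degen (nerve G T) n j h)
      = degen (nerve G T) (n - 1) j (face (nerve G T) n (i - 1) h)"
    using \<open>Suc j < i\<close> \<open>i \<le> Suc n\<close> by (auto simp: nerve_def fun_eq_iff restrict_def)
qed

end

section \<open>Affinely commutative tuples\<close>

context group
begin

abbreviation commute :: "'a \<Rightarrow> 'a \<Rightarrow> bool" where
  "commute x y \<equiv> x \<otimes> y = y \<otimes> x"

lemma mult_inv_cancel_left:
  assumes "x \<in> carrier G" "y \<in> carrier G"
  shows "x \<otimes> (inv x \<otimes> y) = y" "inv x \<otimes> (x \<otimes> y) = y"
  using assms by (simp_all flip: m_assoc)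

lemma commute_mult:
  assumes "commute c x" "commute c y" "c \<in> carrier G" "x \<in> carrier G" "y \<in> carrier G"
  shows "commute c (x \<otimes> y)"
  using assms by (metis m_assoc)

lemma commute_inv:
  assumes "commute c x" "c \<in> carrier G" "x \<in> carrier G"
  shows "commute c (inv x)"
  using assms by (metis inv_closed inv_solve_left inv_solve_right m_assoc m_closed)

text \<open>The centralizer of \<open>c\<close> is a subgroup, \<open>g\<^sub>0\<inverse>g\<^sub>k\<close> is a product of consecutive quotients, and
  \<open>g\<^sub>i\<inverse>g\<^sub>j = (g\<^sub>0\<inverse>g\<^sub>i)\<inverse>(g\<^sub>0\<inverse>g\<^sub>j)\<close>.\<close>

lemma commute_quotient_if_commute_consecutive:
  assumes c: "c \<in> carrier G" and g: "\<And>k. k \<le> n \<Longrightarrow> g k \<in> carrier G"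
    and step: "\<And>k. k < n \<Longrightarrow> commute c (inv g k \<otimes> g (Suc k))"
    and "i \<le> n" "j \<le> n"
  shows "commute c (inv g i \<otimes> g j)"
proof -
  have from_0: "commute c (inv g 0 \<otimes> g k)" if "k \<le> n" for k
    using that
  proof (induction k)
    case 0
    then show ?case using c g[of 0] by simp
  next
    case (Suc k)
    have "commute c ((inv g 0 \<otimes> g k) \<otimes> (inv g k \<otimes> g (Suc k)))"
      by (rule commute_mult) (use c g step Suc in auto)
    moreover have "(inv g 0 \<otimes> g k) \<otimes> (inv g k \<otimes> g (Suc k)) = inv g 0 \<otimes> g (Suc k)"
      using g[of 0] g[of k] g[of "Suc k"] Suc.prems by (simp add: m_assoc mult_inv_cancel_left)
    ultimately show ?case by simp
  qed
  have "commute c (inv (inv g 0 \<otimes> g i) \<otimes> (inv g 0 \<otimes> g j))"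
    by (intro commute_mult[OF commute_inv[OF from_0] from_0])
      (use c g assms(4,5) in simp_all)
  moreover have "inv (inv g 0 \<otimes> g i) \<otimes> (inv g 0 \<otimes> g j) = inv g i \<otimes> g j"
    using g[of 0] g[of i] g[of j] assms(4,5)
    by (simp add: m_assoc inv_mult_group mult_inv_cancel_left)
  ultimately show ?thesis by simp
qed

lemma affinely_commutative_closed:
  "g \<in> affinely_commutative G n \<Longrightarrow> i \<le> n \<Longrightarrow> g i \<in> carrier G"
  by (auto simp: affinely_commutative_def)

text \<open>The preceding lemma is applied twice: first with a consecutive quotient as the fixed element,
  then with an arbitrary one.\<close>

lemma affinely_commutative_quotients_commute:
  assumes g: "g \<in> affinely_commutative G n" and "i \<le> n" "j \<le> n" "k \<le> n" "l \<le> n"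
  shows "commute (inv g i \<otimes> g j) (inv g k \<otimes> g l)"
proof -
  have closed: "g k \<in> carrier G" if "k \<le> n" for k
    using g that by (rule affinely_commutative_closed)
  have consecutive: "commute (inv g m \<otimes> g (Suc m)) (inv g m' \<otimes> g (Suc m'))"
    if "m < n" "m' < n" for m m'
    using g that unfolding affinely_commutative_def by blast
  have half: "commute (inv g m \<otimes> g (Suc m)) (inv g i \<otimes> g j)" if "m < n" for m
    by (rule commute_quotient_if_commute_consecutive[where n = n])
      (use that assms(2,3) closed consecutive in \<open>simp_all only: m_closed inv_closed Suc_leI less_imp_le\<close>)
  show ?thesis
    by (rule commute_quotient_if_commute_consecutive[where n = n])
      (use assms(2-) closed half[symmetric] in \<open>simp_all only: m_closed inv_closed\<close>)
qed

text \<open>The consecutive quotients of the reindexed tuple are quotients of \<open>g\<close>, in general not consecutive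
  ones. Faces and degeneracies are both of this form.\<close>

lemma affinely_commutative_reindex:
  assumes g: "g \<in> affinely_commutative G n" and \<phi>: "\<And>j. j \<le> m \<Longrightarrow> \<phi> j \<le> n"
  shows "(\<lambda>j\<in>{..m}. g (\<phi> j)) \<in> affinely_commutative G m"
  unfolding affinely_commutative_def mem_Collect_eq
proof (intro conjI allI impI)
  show "(\<lambda>j\<in>{..m}. g (\<phi> j)) \<in> {..m} \<rightarrow>\<^sub>E carrier G"
    using affinely_commutative_closed[OF g] \<phi> by simp
next
  fix i j assume "i < m" "j < m"
  then have "\<phi> i \<le> n" "\<phi> (Suc i) \<le> n" "\<phi> j \<le> n" "\<phi> (Suc j) \<le> n"
    using \<phi> by simp_all
  from affinely_commutative_quotients_commute[OF g this] \<open>i < m\<close> \<open>j < m\<close>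
  show "commute (inv (\<lambda>j\<in>{..m}. g (\<phi> j)) i \<otimes> (\<lambda>j\<in>{..m}. g (\<phi> j)) (Suc i))
      (inv (\<lambda>j\<in>{..m}. g (\<phi> j)) j \<otimes> (\<lambda>j\<in>{..m}. g (\<phi> j)) (Suc j))"
    by simp
qed

end

context topological_group
begin

lemma topspace_AfCom: "topspace (level (AfCom G T) n) = affinely_commutative G n"
  by (auto simp: AfCom_def affinely_commutative_def topspace_eq_carrier)

lemma continuous_map_AfCom_coordinate:
  "j \<le> n \<Longrightarrow> continuous_map (level (AfCom G T) n) T (\<lambda>g. g j)"
  unfolding AfCom_def simplicial_data.simps
  by (intro continuous_map_from_subtopology continuous_map_product_projection) simp

lemma continuous_map_AfCom_reindex:
  assumes "\<And>j. j \<le> m \<Longrightarrow> \<phi> j \<le> n"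
  shows "continuous_map (level (AfCom G T) n) (level (AfCom G T) m) (\<lambda>g. \<lambda>j\<in>{..m}. g (\<phi> j))"
proof -
  have "continuous_map (level (AfCom G T) n) (product_topology (\<lambda>_. T) {..m})
      (\<lambda>g. \<lambda>j\<in>{..m}. g (\<phi> j))"
  proof (rule continuous_map_coordinatewise_then_product)
    fix j assume "j \<in> {..m}"
    then show "continuous_map (level (AfCom G T) n) T (\<lambda>g. (\<lambda>j\<in>{..m}. g (\<phi> j)) j)"
      using assms by (simp add: continuous_map_AfCom_coordinate)
  qed auto
  then have "continuous_map (level (AfCom G T) n)
      (subtopology (product_topology (\<lambda>_. T) {..m}) (affinely_commutative G m))
      (\<lambda>g. \<lambda>j\<in>{..m}. g (\<phi> j))"
    using affinely_commutative_reindex assms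
    by (auto simp: continuous_map_in_subtopology topspace_AfCom)
  then show ?thesis
    by (simp add: AfCom_def)
qed

text \<open>Faces and degeneracies written as reindexings, the form to which
  \<open>continuous_map_AfCom_reindex\<close> applies.\<close>

lemma face_AfCom: "face (AfCom G T) n i = (\<lambda>g. \<lambda>j\<in>{..n - 1}. g (if j < i then j else Suc j))"
  by (auto simp: AfCom_def fun_eq_iff restrict_def)

lemma degen_AfCom: "degen (AfCom G T) n i = (\<lambda>g. \<lambda>j\<in>{..Suc n}. g (if j \<le> i then j else j - 1))"
  by (auto simp: AfCom_def fun_eq_iff restrict_def)

lemma simplicial_space_AfCom: "simplicial_space (AfCom G T)"
proof
  fix n i :: nat assume "0 < n" "i \<le> n"
  then show "continuous_map (level (AfCom G T) n) (level (AfCom G T) (n - 1)) (face (AfCom G T) n i)"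
    unfolding face_AfCom by (intro continuous_map_AfCom_reindex) auto
next
  fix n i :: nat assume "i \<le> n"
  then show "continuous_map (level (AfCom G T) n) (level (AfCom G T) (Suc n)) (degen (AfCom G T) n i)"
    unfolding degen_AfCom by (intro continuous_map_AfCom_reindex) auto
next
  fix i j n :: nat and g
  assume "i = j \<or> i = Suc j" "j \<le> n" "g \<in> topspace (level (AfCom G T) n)"
  moreover from this have "g k = undefined" if "\<not> k \<le> n" for k
    using that by (auto simp: topspace_AfCom affinely_commutative_def PiE_iff extensional_def)
  ultimately show "face (AfCom G T) (Suc n) i (degen (AfCom G T) n j g) = g"
    by (auto simp: face_AfCom degen_AfCom fun_eq_iff restrict_def)
qed (auto simp: face_AfCom degen_AfCom fun_eq_iff restrict_def)

end

section \<open>The simplicial commutator map\<close>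

context group
begin

lemma commutator_self: "x \<in> carrier G \<Longrightarrow> commutator G x x = \<one>"
  by (simp add: commutator_def m_assoc)

lemma commutator_in_derived:
  "x \<in> carrier G \<Longrightarrow> y \<in> carrier G \<Longrightarrow> commutator G x y \<in> derived G (carrier G)"
  unfolding derived_eq_generate_commutators by (blast intro: generate.incl)

text \<open>The telescoping identity: with \<open>y = xa\<close> and \<open>z = xab\<close> the left-hand side cancels to
  \<open>x\<inverse>a\<inverse>b\<inverse>xab\<close>, and the right-hand side is \<open>x\<inverse>b\<inverse>a\<inverse>xab\<close>.\<close>

lemma commutator_mult_commutator:
  assumes "x \<in> carrier G" "y \<in> carrier G" "z \<in> carrier G"
    and "commute (inv x \<otimes> y) (inv y \<otimes> z)"
  shows "commutator G x y \<otimes> commutator G y z = commutator G x z"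
proof -
  define a b where "a = inv x \<otimes> y" and "b = inv y \<otimes> z"
  have ab: "a \<in> carrier G" "b \<in> carrier G" "commute a b"
    unfolding a_def b_def using assms by (blast intro: m_closed inv_closed)+
  have y: "y = x \<otimes> a" and z: "z = x \<otimes> (a \<otimes> b)"
    using assms(1-3) by (simp_all add: a_def b_def m_assoc mult_inv_cancel_left)
  have "inv a \<otimes> inv b = inv b \<otimes> inv a"
    using ab by (metis inv_mult_group)
  \<comment> \<open>The form that rewrites inside products associated to the right.\<close>
  then have "inv a \<otimes> (inv b \<otimes> v) = inv b \<otimes> (inv a \<otimes> v)" if "v \<in> carrier G" for v
    using ab that by (simp flip: m_assoc)
  then show ?thesis
    unfolding y z commutator_def using assms(1) ab by (simp add: m_assoc inv_mult_group mult_inv_cancel_left)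
qed

end

context topological_group
begin

lemma topological_group_commutator_subgroup:
  "topological_group (commutator_subgroup G) (commutator_topology G T)"
  unfolding commutator_subgroup_def commutator_topology_def
  by (intro topological_group_subgroup derived_is_subgroup) simp

lemma continuous_map_commutator_map:
  "continuous_map (level (AfCom G T) n)
     (level (nerve (commutator_subgroup G) (commutator_topology G T)) n) (commutator_map G n)"
  unfolding nerve_def simplicial_data.simps
proof (rule continuous_map_coordinatewise_then_product)
  fix i assume i: "i \<in> {..<n}"
  then have "continuous_map (level (AfCom G T) n) T (\<lambda>g. commutator G (g i) (g (Suc i)))"
    by (intro continuous_map_commutator continuous_map_AfCom_coordinate) auto
  moreover have "commutator G (g i) (g (Suc i)) \<in> derived G (carrier G)"
    if "g \<in> affinely_commutative G n" for g
    using that i by (intro commutator_in_derived) (auto intro: affinely_commutative_closed)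
  ultimately show "continuous_map (level (AfCom G T) n) (commutator_topology G T)
      (\<lambda>g. commutator_map G n g i)"
    using i by (auto simp: commutator_topology_def commutator_map_def topspace_AfCom
        continuous_map_in_subtopology)
qed (simp add: commutator_map_def)

lemma simplicial_map_commutator_map:
  "simplicial_map (AfCom G T) (nerve (commutator_subgroup G) (commutator_topology G T))
     (commutator_map G)"
proof (intro simplicial_map.intro simplicial_map_axioms.intro simplicial_space_AfCom
    topological_group.simplicial_space_nerve topological_group_commutator_subgroup
    continuous_map_commutator_map)
  fix n i :: nat and g
  assume n: "0 < n" "i \<le> n" and g: "g \<in> topspace (level (AfCom G T) n)"
  then have g: "g \<in> affinely_commutative G n" by (simp add: topspace_AfCom)
  have "commutator G (g j) (g (Suc j)) \<otimes> commutator G (g (Suc j)) (g (Suc (Suc j)))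
      = commutator G (g j) (g (Suc (Suc j)))" if "Suc j < n" for j
    using that by (intro commutator_mult_commutator affinely_commutative_quotients_commute[OF g]
        affinely_commutative_closed[OF g]) auto
  with n show "commutator_map G (n - 1) (face (AfCom G T) n i g)
      = face (nerve (commutator_subgroup G) (commutator_topology G T)) n i (commutator_map G n g)"
    by (auto simp: commutator_map_def face_AfCom nerve_def fun_eq_iff restrict_def
        commutator_subgroup_def)
next
  fix n i :: nat and g
  assume i: "i \<le> n" and "g \<in> topspace (level (AfCom G T) n)"
  then have "commutator G (g i) (g i) = \<one>"
    by (intro commutator_self) (auto simp: topspace_AfCom intro: affinely_commutative_closed)
  with i show "commutator_map G (Suc n) (degen (AfCom G T) n i g)
      = degen (nerve (commutator_subgroup G) (commutator_topology G T)) n i (commutator_map G n g)"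
    by (auto simp: commutator_map_def degen_AfCom nerve_def fun_eq_iff restrict_def
        commutator_subgroup_def)
qed

end

theorem lemma17:
  fixes G :: "('a, 'b) monoid_scheme" and T :: "'a topology"
  assumes "topological_group G T"
  shows "simplicial_map (AfCom G T) (nerve (commutator_subgroup G) (commutator_topology G T))
           (commutator_map G)
       \<and> continuous_map (Ecom G T)
           (classifying_space (commutator_subgroup G) (commutator_topology G T))
           (realized_commutator_map G T)
       \<and> (\<forall>n. \<forall>g \<in> topspace (level (AfCom G T) n). \<forall>t \<in> standard_simplex n.
            realized_commutator_map G T (realization_class (AfCom G T) (n, g, t))
              = realization_class (nerve (commutator_subgroup G) (commutator_topology G T))
                  (n, commutator_map G n g, t))"
proof -
  interpret topological_group G T by (fact assms)
  interpret c: simplicial_map "AfCom G T" "nerve (commutator_subgroup G) (commutator_topology G T)"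
    "commutator_map G"
    by (fact simplicial_map_commutator_map)
  show ?thesis
    unfolding Ecom_def classifying_space_def realized_commutator_map_def
    using simplicial_map_commutator_map c.continuous_map_realization c.realization_map_class by blast
qed

end
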